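(* Let $d\geqslant 2$ be an integer, and let $r\leqslant d-2$ be an integer with $\gcd(r,d)=1$. Then for all positive integers $n$ with $n\equiv -r\pmod{d}$ and $n\geqslant d-r$, \[ \sum_{k=0}^{n-1}\frac{(q^r;q^d)_k^d\, q^{dk}}{(q^d;q^d)_k^d}\equiv 0 \pmod{\Phi_n(q)^2}. \]
   Context: For an indeterminate $q$, $(a;q)_k=(1-a)(1-aq)\cdots(1-aq^{k-1})$ (with $(a;q)_0=1$) is the $q$-shifted factorial. $\Phi_n(q)$ denotes the $n$-th cyclotomic polynomial. For rational functions $A(q)/B(q)$ whose denominator $B(q)$ is coprime to a polynomial $P(q)$, the congruence $A/B\equiv 0\pmod{P}$ means that $P$ divides $A$ (in the ring of Laurent polynomials in $q$ with rational coefficients); congruences between such rational functions are understood accordingly. *)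

theory Defs
  imports
    "HOL-Computational_Algebra.Computational_Algebra"
    "HOL-Computational_Algebra.Field_as_Ring"
    "HOL-Number_Theory.Cong"
    Complex_Main
begin

text \<open>
  The field of rational functions in the indeterminate \<open>q\<close> is \<open>rat poly fract\<close>; the
  polynomial ring embeds into it via \<^const>\<open>to_fract\<close>.
\<close>

definition q_var :: "rat poly fract" where
  "q_var = to_fract [:0, 1:]"

definition q_pochhammer :: "'a :: comm_ring_1 \<Rightarrow> 'a \<Rightarrow> nat \<Rightarrow> 'a" where
  "q_pochhammer a q k = (\<Prod>j<k. 1 - a * q ^ j)"


text \<open>
  The recursion comes from $q^n - 1 = \prod_{m \mid n} \Phi_m(q)$.  The value at \<open>n = 0\<close> is
  junk (the zero polynomial).  The product of $q - w$ over the primitive \<open>n\<close>-th roots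
  of unity \<open>w\<close> is recovered in \<open>cyclotomic_conv_primitive_roots\<close> below.
\<close>

function cyclotomic :: "nat \<Rightarrow> rat poly" where
  "cyclotomic n = (monom 1 n - 1) div (\<Prod>m\<in>{m. m < n \<and> m dvd n}. cyclotomic m)"
  by auto
termination by (relation "measure id") auto

declare cyclotomic.simps [simp del]

definition primitive_roots_unity :: "nat \<Rightarrow> complex set" where
  "primitive_roots_unity n = {w. w ^ n = 1 \<and> (\<forall>m. 0 < m \<and> m < n \<longrightarrow> w ^ m \<noteq> 1)}"

lemma roots_unity_conv_primitive:
  assumes "n > 0"
  shows "{w :: complex. w ^ n = 1} = (\<Union>m\<in>{m. m dvd n}. primitive_roots_unity m)"
proof (intro equalityI subsetI)
  fix w :: complex
  assume "w \<in> {w. w ^ n = 1}"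
  hence w: "w ^ n = 1" by simp
  define m where "m = (LEAST m. 0 < m \<and> w ^ m = 1)"
  have m: "0 < m" "w ^ m = 1"
    using LeastI [of "\<lambda>m. 0 < m \<and> w ^ m = 1" n] assms w by (auto simp: m_def)
  have least: "w ^ k \<noteq> 1" if "0 < k" "k < m" for k
    using not_less_Least [of k "\<lambda>m. 0 < m \<and> w ^ m = 1"] that by (auto simp: m_def)
  have "w ^ (n mod m) = 1"
  proof -
    have "w ^ n = (w ^ m) ^ (n div m) * w ^ (n mod m)"
      by (simp flip: power_mult power_add)
    thus ?thesis using w m by simp
  qed
  hence "n mod m = 0"
    using least [of "n mod m"] m by auto
  thus "w \<in> (\<Union>m\<in>{m. m dvd n}. primitive_roots_unity m)"
    using m least by (auto simp: primitive_roots_unity_def mod_eq_0_iff_dvd)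
next
  fix w assume "w \<in> (\<Union>m\<in>{m. m dvd n}. primitive_roots_unity m)"
  thus "w \<in> {w. w ^ n = 1}"
    by (auto simp: primitive_roots_unity_def elim!: dvdE simp: power_mult)
qed

lemma finite_primitive_roots_unity:
  "n > 0 \<Longrightarrow> finite (primitive_roots_unity n)"
  by (rule finite_subset [OF _ finite_roots_unity [of n]])
     (auto simp: primitive_roots_unity_def)

lemma monom_minus_one_conv_roots:
  assumes "n > 0"
  shows "monom 1 n - 1 = (\<Prod>w\<in>{w :: complex. w ^ n = 1}. [:-w, 1:])" (is "?p = ?r")
proof (rule ccontr)
  assume neq: "?p \<noteq> ?r"
  let ?A = "{w :: complex. w ^ n = 1}"
  have fin: "finite ?A" using assms by (intro finite_roots_unity) auto
  have card: "card ?A = n" using card_roots_unity_eq [OF assms] by simp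
  have degr: "degree ?r = n" using card by (subst degree_prod_eq_sum_degree) auto
  have "lead_coeff ?r = 1" by (simp add: lead_coeff_prod)
  hence c: "coeff (?p - ?r) n = 0" using degr assms by (simp add: coeff_monom)
  have "degree ?p \<le> n" by (intro degree_diff_le) (auto simp: degree_monom_le)
  hence "degree (?p - ?r) \<le> n" using \<open>degree ?p \<le> n\<close> degr by (metis degree_diff_le order_refl)
  hence "degree (?p - ?r) < n"
    using c neq by (metis eq_zero_or_degree_less right_minus_eq)
  moreover have "?A \<subseteq> {x. poly (?p - ?r) x = 0}"
    using fin by (auto simp: poly_monom poly_prod)
  hence "n \<le> card {x. poly (?p - ?r) x = 0}"
    using card_mono [OF poly_roots_finite] neq card by (metis right_minus_eq)
  moreover have "card {x. poly (?p - ?r) x = 0} \<le> degree (?p - ?r)"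
    using neq by (intro card_poly_roots_bound) auto
  ultimately show False by linarith
qed

lemma map_poly_of_rat_mult:
  "map_poly of_rat (p * q) =
     (map_poly of_rat p * map_poly of_rat q :: 'a :: field_char_0 poly)"
  by (intro poly_eqI) (simp add: coeff_map_poly coeff_mult of_rat_sum of_rat_mult)

lemma map_poly_of_rat_prod:
  "map_poly of_rat (\<Prod>x\<in>A. f x) = (\<Prod>x\<in>A. map_poly of_rat (f x) :: 'a :: field_char_0 poly)"
  by (induction A rule: infinite_finite_induct) (simp_all add: map_poly_of_rat_mult)

lemma map_poly_of_rat_diff:
  "map_poly of_rat (p - q) =
     (map_poly of_rat p - map_poly of_rat q :: 'a :: field_char_0 poly)"
  by (intro poly_eqI) (simp add: coeff_map_poly of_rat_diff)

lemma map_poly_of_rat_dvdD: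
  assumes "map_poly of_rat p dvd (map_poly of_rat q :: 'a :: field_char_0 poly)" "p \<noteq> 0"
  shows "p dvd q"
proof -
  have "map_poly of_rat p dvd (map_poly of_rat (q mod p) :: 'a poly)"
    using assms(1)
    by (metis dvd_diff dvd_triv_right map_poly_of_rat_diff map_poly_of_rat_mult minus_div_mult_eq_mod)
  moreover have "degree (map_poly of_rat (q mod p) :: 'a poly) = degree (q mod p)"
       "degree (map_poly of_rat p :: 'a poly) = degree p"
    by (auto intro!: degree_map_poly)
  ultimately have "map_poly of_rat (q mod p) = (0 :: 'a poly) \<or> degree p \<le> degree (q mod p)"
    using dvd_imp_degree_le by metis
  hence "q mod p = 0"
    using degree_mod_less [OF assms(2), of q] by (auto simp: poly_eq_iff coeff_map_poly)
  thus ?thesis by auto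
qed

theorem cyclotomic_conv_primitive_roots:
  assumes "n > 0"
  shows "map_poly of_rat (cyclotomic n) = (\<Prod>w\<in>primitive_roots_unity n. [:-w, 1:])"
  using assms
proof (induction n rule: less_induct)
  case (less n)
  define D where "D = {m. m < n \<and> m dvd n}"
  have D: "finite D" "n \<notin> D" "{m. m dvd n} = insert n D" "\<And>m. m \<in> D \<Longrightarrow> m > 0"
    using less.prems by (auto simp: D_def dest: dvd_imp_le intro: Nat.gr0I)
  define P where "P = (\<Prod>m\<in>D. cyclotomic m)"
  let ?h = "map_poly of_rat :: rat poly \<Rightarrow> complex poly"
  let ?c = "\<lambda>m. \<Prod>w\<in>primitive_roots_unity m. [:-w, 1:]"
  have hP: "?h P = (\<Prod>m\<in>D. ?c m)"
    unfolding P_def map_poly_of_rat_prod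
    using less.IH D by (intro prod.cong refl) (auto simp: D_def)
  have "?h (monom 1 n - 1) = monom 1 n - 1"
    by (simp add: map_poly_of_rat_diff map_poly_monom)
  also have "\<dots> = (\<Prod>w\<in>(\<Union>m\<in>{m. m dvd n}. primitive_roots_unity m). [:-w, 1:])"
    using less.prems by (simp add: monom_minus_one_conv_roots roots_unity_conv_primitive)
  also have "\<dots> = (\<Prod>m\<in>{m. m dvd n}. ?c m)"
  proof (intro prod.UNION_disjoint ballI impI)
    show "finite {m. m dvd n}" using D by simp
    show "finite (primitive_roots_unity m)" if "m \<in> {m. m dvd n}" for m
      using that less.prems D by (intro finite_primitive_roots_unity) (auto intro: Nat.gr0I)
    show "primitive_roots_unity i \<inter> primitive_roots_unity j = {}"
      if "i \<in> {m. m dvd n}" "j \<in> {m. m dvd n}" "i \<noteq> j" for i j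
    proof -
      have "i > 0" "j > 0" using that less.prems by (auto intro: Nat.gr0I)
      thus ?thesis using that(3)
        by (auto simp: primitive_roots_unity_def) (metis nat_neq_iff)
    qed
  qed
  also have "\<dots> = ?c n * ?h P" using D by (simp add: hP)
  finally have eq: "?h (monom 1 n - 1) = ?c n * ?h P" .
  have nz: "?h P \<noteq> 0"
    unfolding hP using D finite_primitive_roots_unity by auto
  hence "P \<noteq> 0" by auto
  hence "P dvd monom 1 n - 1"
    using eq by (intro map_poly_of_rat_dvdD [where 'a = complex]) auto
  hence "monom 1 n - 1 = cyclotomic n * P"
    by (subst cyclotomic.simps) (simp add: P_def D_def)
  hence "?h (cyclotomic n) * ?h P = ?c n * ?h P"
    using eq by (simp add: map_poly_of_rat_mult)
  thus ?case using nz by simp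
qed


definition laurent_polys :: "rat poly fract set" where
  "laurent_polys = {to_fract p * q_var powi m | p m. True}"

definition laurent_dvd :: "rat poly fract \<Rightarrow> rat poly fract \<Rightarrow> bool" where
  "laurent_dvd P A \<longleftrightarrow> (\<exists>C\<in>laurent_polys. A = P * C)"

text \<open>
  \<open>ratfun_cong_0 f P\<close> is the congruence $f \equiv 0 \pmod P$.  By \<open>ratfun_cong_0_iff\<close> below, it
  does not matter which admissible representation $f = A/B$ is chosen.
\<close>

definition ratfun_cong_0 :: "rat poly fract \<Rightarrow> rat poly \<Rightarrow> bool" where
  "ratfun_cong_0 f P \<longleftrightarrow>
     (\<exists>A\<in>laurent_polys. \<exists>B. B \<noteq> 0 \<and> coprime B P \<and> f = A / to_fract B \<and>
        laurent_dvd (to_fract P) A)"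

lemma q_var_nonzero [simp]: "q_var \<noteq> 0"
  by (simp add: q_var_def)

lemma q_var_power: "q_var ^ n = to_fract (monom 1 n)"
  by (induction n) (simp_all add: q_var_def monom_Suc flip: to_fract_mult one_pCons)

lemma to_fract_in_laurent_polys: "to_fract p \<in> laurent_polys"
  unfolding laurent_polys_def by (intro CollectI exI [of _ p] exI [of _ 0]) simp

lemma laurent_polys_mult:
  assumes "x \<in> laurent_polys" "y \<in> laurent_polys"
  shows "x * y \<in> laurent_polys"
proof -
  obtain a b m k where "x = to_fract a * q_var powi m" "y = to_fract b * q_var powi k"
    using assms by (auto simp: laurent_polys_def)
  hence "x * y = to_fract (a * b) * q_var powi (m + k)"
    by (simp add: power_int_add mult_ac)
  thus ?thesis unfolding laurent_polys_def by blast
qed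

lemma laurent_polys_add:
  assumes "x \<in> laurent_polys" "y \<in> laurent_polys"
  shows "x + y \<in> laurent_polys"
proof -
  obtain a b m k where xy: "x = to_fract a * q_var powi m" "y = to_fract b * q_var powi k"
    using assms by (auto simp: laurent_polys_def)
  define l where "l = min m k"
  have *: "q_var powi i = to_fract (monom 1 (nat (i - l))) * q_var powi l" if "i \<ge> l" for i
  proof -
    have "q_var powi i = q_var powi (int (nat (i - l))) * q_var powi l"
      using that by (simp flip: power_int_add)
    also have "q_var powi (int (nat (i - l))) = to_fract (monom 1 (nat (i - l)))"
      by (simp only: power_int_of_nat q_var_power)
    finally show ?thesis .
  qed
  have "x + y = to_fract (a * monom 1 (nat (m - l)) + b * monom 1 (nat (k - l))) * q_var powi l"
    unfolding xy using * [of m] * [of k] by (simp add: l_def algebra_simps)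
  thus ?thesis unfolding laurent_polys_def by blast
qed

lemma ratfun_cong_0_iff:
  assumes "A \<in> laurent_polys" "B \<noteq> 0" "coprime B P"
  shows "ratfun_cong_0 (A / to_fract B) P \<longleftrightarrow> laurent_dvd (to_fract P) A"
proof
  assume "laurent_dvd (to_fract P) A"
  thus "ratfun_cong_0 (A / to_fract B) P"
    using assms by (auto simp: ratfun_cong_0_def)
next
  assume "ratfun_cong_0 (A / to_fract B) P"
  then obtain A' B' C where *: "B' \<noteq> 0" "coprime B' P" "A / to_fract B = A' / to_fract B'"
      "C \<in> laurent_polys" "A' = to_fract P * C"
    by (auto simp: ratfun_cong_0_def laurent_dvd_def)
  obtain s t where "s * B' + t * P = 1"
    using bezout_coefficients_fst_snd [of B' P] * (2) by auto
  hence st: "to_fract s * to_fract B' + to_fract t * to_fract P = 1"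
    by (metis to_fract_1 to_fract_add to_fract_mult)
  have "A * to_fract B' = to_fract P * C * to_fract B"
    using * assms(2) by (simp add: field_simps)
  hence "A = to_fract P * (to_fract s * C * to_fract B + to_fract t * A)"
    using st by algebra
  moreover have "to_fract s * C * to_fract B + to_fract t * A \<in> laurent_polys"
    by (intro laurent_polys_add laurent_polys_mult to_fract_in_laurent_polys assms *)
  ultimately show "laurent_dvd (to_fract P) A"
    unfolding laurent_dvd_def by blast
qed

end

theory Submission
  imports Defs
begin

text \<open>
  Put $p = q^d$, $n + r = d (m + 1)$ and $N = n - m - 1$.  Replacing one factor $(q^r;p)_k$ of the
  numerator by $(q^{r-(d-1)n};p)_k = (p^{-N};p)_k$ and each of the other $d - 1$ factors by
  $(q^{r+n};p)_k = (p^{m+1};p)_k$ leaves it unchanged modulo $(1-q^n)^2$, because the product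
  of the perturbations $q^{-(d-1)n}, q^n, \dots, q^n$ is $1$ and hence the first-order terms cancel.
  The perturbed sum vanishes identically (a terminating Karlsson--Minton sum):
  $(p^{m+1};p)_k / (p;p)_k$ is a polynomial in $p^k$ of degree $m$, the hypothesis $r \le d - 2$
  says exactly that $(d-1)m < N$, and $\sum_k (p^{-N};p)_k p^{(i+1)k} / (p;p)_k = 0$ for $i < N$
  by the \<open>q\<close>-binomial theorem.
\<close>

section \<open>A terminating Karlsson--Minton sum\<close>

lemma q_pochhammer_0 [simp]: "q_pochhammer a q 0 = 1"
  by (simp add: q_pochhammer_def)

lemma q_pochhammer_Suc: "q_pochhammer a q (Suc k) = q_pochhammer a q k * (1 - a * q ^ k)"
  by (simp add: q_pochhammer_def)

lemma q_pochhammer_Suc_shift: "q_pochhammer a q (Suc k) = (1 - a) * q_pochhammer (a * q) q k"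
  unfolding q_pochhammer_def by (subst prod.lessThan_Suc_shift) (simp add: mult_ac)

lemma q_pochhammer_add:
  "q_pochhammer a q (j + k) = q_pochhammer a q j * q_pochhammer (a * q ^ j) q k"
  by (induction k) (simp_all add: q_pochhammer_Suc power_add mult_ac)

lemma q_pochhammer_self_nonzero:
  fixes p :: "'a :: field"
  assumes "\<And>j. j > 0 \<Longrightarrow> p ^ j \<noteq> 1"
  shows "q_pochhammer p p k \<noteq> 0"
  unfolding q_pochhammer_def using assms [of "Suc _"] by auto

text \<open>The factor with index \<open>N\<close> is \<open>1 - inverse p ^ N * p ^ N = 0\<close>;
  this terminates the series below.\<close>

lemma q_pochhammer_inverse_power_eq_0:
  fixes p :: "'a :: field"
  assumes "p \<noteq> 0" "N < k"
  shows "q_pochhammer (inverse p ^ N) p k = 0"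
  unfolding q_pochhammer_def using assms
  by (auto intro!: bexI [of _ N] simp flip: power_mult_distrib)

text \<open>The coefficients obey a Pascal-type rule in \<open>N\<close>, and summing it produces
  the new factor \<open>1 - z * inverse p ^ Suc N\<close>. Terms with \<open>k > N\<close> vanish,
  so every \<open>K > N\<close> gives the same sum; the induction keeps \<open>K\<close> arbitrary
  because it needs the sums for both \<open>K\<close> and \<open>K - 1\<close>.\<close>

lemma q_binomial_terminating:
  fixes p z :: "'a :: field"
  assumes p: "p \<noteq> 0" "\<And>j. j > 0 \<Longrightarrow> p ^ j \<noteq> 1" and "N < K"
  shows "(\<Sum>k<K. q_pochhammer (inverse p ^ N) p k / q_pochhammer p p k * z ^ k) =
           (\<Prod>j<N. 1 - z * inverse p ^ Suc j)"
  using \<open>N < K\<close>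
proof (induction N arbitrary: K)
  case 0
  then obtain K' where "K = Suc K'" by (cases K) auto
  thus ?case
    using q_pochhammer_inverse_power_eq_0 [OF p(1), of 0]
    by (simp add: sum.lessThan_Suc_shift del: sum.lessThan_Suc)
next
  case (Suc N)
  define a where "a = inverse p ^ N"
  define c where "c b k = q_pochhammer b p k / q_pochhammer p p k * z ^ k" for b k
  obtain K' where K: "K = Suc K'" "N < K'" using Suc.prems by (cases K) auto
  \<comment> \<open>With \<open>b = a / p\<close>, split \<open>1 - b\<close> as
    \<open>(1 - a * p ^ k) - b * (1 - p * p ^ k)\<close>. The first part extends the product that
    starts at \<open>a\<close>; the second cancels the last factor of the denominator.\<close>
  have step: "c (inverse p * a) (Suc k) = c a (Suc k) - z * inverse p * a * c a k" for k
  proof -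
    define b where "b = inverse p * a"
    have a: "a = b * p" using p(1) by (simp add: b_def)
    define A Q R where "A = q_pochhammer a p k" and "Q = q_pochhammer p p k" and "R = 1 - p * p ^ k"
    have nz: "Q \<noteq> 0" "R \<noteq> 0"
      using q_pochhammer_self_nonzero [OF p(2)] p(2) [of "Suc k"] by (auto simp: Q_def R_def)
    have "c b (Suc k) = (1 - b) * A / (Q * R) * z ^ Suc k"
      unfolding c_def q_pochhammer_Suc_shift [of b]
      by (simp add: q_pochhammer_Suc A_def Q_def R_def a)
    also have "1 - b = (1 - a * p ^ k) - b * R"
      by (simp add: a R_def algebra_simps)
    also have "\<dots> * A / (Q * R) * z ^ Suc k
                 = A * (1 - a * p ^ k) / (Q * R) * z ^ Suc k - z * b * (A / Q * z ^ k)"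
      using nz by (simp add: field_simps)
    also have "\<dots> = c a (Suc k) - z * b * c a k"
      by (simp add: c_def q_pochhammer_Suc A_def Q_def R_def)
    finally show ?thesis by (simp add: b_def mult.assoc)
  qed
  have "(\<Sum>k<K. c (inverse p * a) k) = 1 + (\<Sum>k<K'. c (inverse p * a) (Suc k))"
    by (simp add: K sum.lessThan_Suc_shift c_def del: sum.lessThan_Suc)
  also have "\<dots> = (1 + (\<Sum>k<K'. c a (Suc k))) - z * inverse p * a * (\<Sum>k<K'. c a k)"
    by (simp add: step sum_subtractf sum_distrib_left del: mult.assoc)
  also have "1 + (\<Sum>k<K'. c a (Suc k)) = (\<Sum>k<K. c a k)"
    by (simp add: K sum.lessThan_Suc_shift c_def del: sum.lessThan_Suc)
  also have "(\<Sum>k<K. c a k) = (\<Prod>j<N. 1 - z * inverse p ^ Suc j)"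
    unfolding c_def a_def using Suc.IH [of K] Suc.prems by simp
  also have "(\<Sum>k<K'. c a k) = (\<Prod>j<N. 1 - z * inverse p ^ Suc j)"
    unfolding c_def a_def using Suc.IH [of K'] K by simp
  finally show ?case
    by (simp add: c_def a_def algebra_simps)
qed

text \<open>Each monomial of degree \<open>i\<close> in \<open>f\<close> gives the q-binomial sum at
  \<open>z = p ^ Suc i\<close>, whose product side has the zero factor \<open>j = i\<close>. The
  weight \<open>p ^ k\<close> shifts the exponents into the range from 1 to \<open>N\<close>, where
  the product vanishes.\<close>

lemma sum_q_binomial_poly_eq_0:
  fixes p :: "'a :: field"
  assumes p: "p \<noteq> 0" "\<And>j. j > 0 \<Longrightarrow> p ^ j \<noteq> 1" and "N < K" "degree f < N"
  shows "(\<Sum>k<K. q_pochhammer (inverse p ^ N) p k / q_pochhammer p p k * p ^ k * poly f (p ^ k)) = 0"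
proof -
  define c where "c k = q_pochhammer (inverse p ^ N) p k / q_pochhammer p p k" for k
  have *: "(\<Sum>k<K. c k * (p ^ Suc i) ^ k) = 0" if "i < N" for i
  proof -
    have "(\<Sum>k<K. c k * (p ^ Suc i) ^ k) = (\<Prod>j<N. 1 - p ^ Suc i * inverse p ^ Suc j)"
      unfolding c_def by (rule q_binomial_terminating [OF p \<open>N < K\<close>])
    moreover
    have "1 - p ^ Suc i * inverse p ^ Suc i = 0"
      using p(1) by (simp flip: power_mult_distrib del: power_Suc)
    ultimately show ?thesis
      using that by (auto simp del: power_Suc)
  qed
  have "(\<Sum>k<K. c k * p ^ k * poly f (p ^ k)) =
          (\<Sum>k<K. \<Sum>i\<le>degree f. coeff f i * (c k * (p ^ Suc i) ^ k))"
    by (simp add: poly_altdef sum_distrib_left power_mult_distrib mult_ac flip: power_mult)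
  also have "\<dots> = (\<Sum>i\<le>degree f. coeff f i * (\<Sum>k<K. c k * (p ^ Suc i) ^ k))"
    by (subst sum.swap) (simp add: sum_distrib_left)
  also have "\<dots> = 0"
    using * \<open>degree f < N\<close> by (intro sum.neutral) auto
  finally show ?thesis by (simp add: c_def)
qed

text \<open>Splitting \<open>(p;p)_(m+k)\<close> after \<open>m\<close> or after \<open>k\<close>
  factors shows that \<open>(p^(m+1);p)_k / (p;p)_k\<close> is a constant times \<open>g\<close> at
  \<open>p ^ k\<close>, with \<open>g\<close> of degree at most \<open>m\<close>. The
  \<open>s\<close> such quotients form a polynomial of degree at most
  \<open>s * m < N\<close>.\<close>

lemma q_Karlsson_Minton_eq_0:
  fixes p :: "'a :: field"
  assumes p: "p \<noteq> 0" "\<And>j. j > 0 \<Longrightarrow> p ^ j \<noteq> 1" and "N < K" "s * m < N"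
  shows "(\<Sum>k<K. q_pochhammer (inverse p ^ N) p k * q_pochhammer (p ^ Suc m) p k ^ s * p ^ k
                   / q_pochhammer p p k ^ Suc s) = 0"
proof -
  define g where "g = (\<Prod>j<m. [:1, - (p ^ Suc j):])"
  define f where "f = smult (inverse (q_pochhammer p p m) ^ s) (g ^ s)"
  note nz = q_pochhammer_self_nonzero [OF p(2)]
  have "degree g \<le> (\<Sum>j<m. degree [:1, - (p ^ Suc j):])"
    unfolding g_def using degree_prod_sum_le [of "{..<m}" "\<lambda>j. [:1, - (p ^ Suc j):]"]
    by (simp only: comp_def finite_lessThan)
  also have "\<dots> \<le> (\<Sum>j<m. 1)" by (intro sum_mono) auto
  finally have g: "degree g \<le> m" by simp
  have "degree f \<le> degree (g ^ s)" unfolding f_def by (rule degree_smult_le)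
  also have "\<dots> \<le> degree g * s" by (rule degree_power_le)
  also have "\<dots> \<le> s * m" using g by simp
  finally have f: "degree f < N" using \<open>s * m < N\<close> by simp
  have ratio: "q_pochhammer (p ^ Suc m) p k ^ s / q_pochhammer p p k ^ s = poly f (p ^ k)" for k
  proof -
    have "q_pochhammer p p m * q_pochhammer (p ^ Suc m) p k
            = q_pochhammer p p k * q_pochhammer (p ^ Suc k) p m"
      using q_pochhammer_add [of p p m k] q_pochhammer_add [of p p k m] by (simp add: add.commute)
    moreover have "q_pochhammer (p ^ Suc k) p m = poly g (p ^ k)"
      by (simp add: g_def q_pochhammer_def poly_prod mult_ac)
    ultimately have
      "q_pochhammer (p ^ Suc m) p k / q_pochhammer p p k = poly g (p ^ k) / q_pochhammer p p m"
      using nz [of k] nz [of m] by (simp add: field_simps)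
    thus ?thesis
      by (simp add: f_def field_simps flip: power_divide)
  qed
  have "(\<Sum>k<K. q_pochhammer (inverse p ^ N) p k * q_pochhammer (p ^ Suc m) p k ^ s * p ^ k
                  / q_pochhammer p p k ^ Suc s) =
        (\<Sum>k<K. q_pochhammer (inverse p ^ N) p k / q_pochhammer p p k * p ^ k * poly f (p ^ k))"
    by (simp flip: ratio add: mult_ac)
  thus ?thesis
    using sum_q_binomial_poly_eq_0 [OF p \<open>N < K\<close> f] by simp
qed

section \<open>Congruences of Laurent polynomials\<close>

lemma laurent_polys_0 [simp]: "0 \<in> laurent_polys"
  and laurent_polys_1 [simp]: "1 \<in> laurent_polys"
  using to_fract_in_laurent_polys [of 0] to_fract_in_laurent_polys [of 1] by simp_all

lemma laurent_polys_uminus: "x \<in> laurent_polys \<Longrightarrow> - x \<in> laurent_polys"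
  using laurent_polys_mult [OF to_fract_in_laurent_polys [of "- 1"]] by fastforce

lemma laurent_polys_diff: "x \<in> laurent_polys \<Longrightarrow> y \<in> laurent_polys \<Longrightarrow> x - y \<in> laurent_polys"
  using laurent_polys_add laurent_polys_uminus by fastforce

lemma laurent_polys_power: "x \<in> laurent_polys \<Longrightarrow> x ^ k \<in> laurent_polys"
  by (induction k) (simp_all add: laurent_polys_mult)

lemma laurent_polys_sum: "(\<And>i. i \<in> I \<Longrightarrow> f i \<in> laurent_polys) \<Longrightarrow> sum f I \<in> laurent_polys"
  by (induction I rule: infinite_finite_induct) (simp_all add: laurent_polys_add)

lemma q_var_powi_in_laurent_polys: "q_var powi m \<in> laurent_polys"
  unfolding laurent_polys_def by (intro CollectI exI [of _ 1] exI [of _ m]) simp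

lemmas laurent_polys_closed =
  laurent_polys_add laurent_polys_mult laurent_polys_uminus laurent_polys_diff laurent_polys_power
  laurent_polys_sum

text \<open>Membership of both sides is built in, so that transitivity and products need no side
  conditions.\<close>

definition laurent_cong :: "rat poly fract \<Rightarrow> rat poly fract \<Rightarrow> rat poly fract \<Rightarrow> bool" where
  "laurent_cong e x y \<longleftrightarrow>
     x \<in> laurent_polys \<and> y \<in> laurent_polys \<and> (\<exists>c\<in>laurent_polys. x - y = e * c)"

lemma laurent_cong_refl: "x \<in> laurent_polys \<Longrightarrow> laurent_cong e x x"
  unfolding laurent_cong_def by (auto intro: bexI [of _ 0])

lemma laurent_cong_trans:
  assumes "laurent_cong e x y" "laurent_cong e y z"
  shows "laurent_cong e x z"
proof -
  obtain c c' where c: "c \<in> laurent_polys" "x - y = e * c" "c' \<in> laurent_polys" "y - z = e * c'"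
    using assms by (auto simp: laurent_cong_def)
  hence "x - z = e * (c + c')" by algebra
  thus ?thesis
    using assms c laurent_polys_add unfolding laurent_cong_def by blast
qed

lemma laurent_cong_mult:
  assumes "laurent_cong e x y" "laurent_cong e x' y'"
  shows "laurent_cong e (x * x') (y * y')"
proof -
  obtain c c' where c: "c \<in> laurent_polys" "x - y = e * c" "c' \<in> laurent_polys" "x' - y' = e * c'"
    using assms by (auto simp: laurent_cong_def)
  hence "x * x' - y * y' = e * (c * x' + y * c')" by algebra
  moreover have "c * x' + y * c' \<in> laurent_polys"
    using assms c by (auto simp: laurent_cong_def intro!: laurent_polys_closed)
  ultimately show ?thesis
    using assms unfolding laurent_cong_def by (auto intro!: laurent_polys_mult)
qed

lemma laurent_cong_prod:
  "(\<And>i. i \<in> I \<Longrightarrow> laurent_cong e (f i) (g i)) \<Longrightarrow> laurent_cong e (prod f I) (prod g I)"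
  by (induction I rule: infinite_finite_induct)
     (simp_all add: laurent_cong_mult laurent_cong_refl)

text \<open>The perturbing factors \<open>v ^ s, u, ..., u\<close> have product 1, so to first order
  in \<open>1 - u\<close> their deviations from 1 add up to 0, and only second-order terms
  remain.\<close>

lemma laurent_cong_perturb:
  assumes "u \<in> laurent_polys" "v \<in> laurent_polys" "w \<in> laurent_polys" "u * v = 1"
  shows "laurent_cong ((1 - u)\<^sup>2) ((1 - v ^ s * w) * (1 - u * w) ^ s) ((1 - w) ^ Suc s)"
proof (induction s)
  case 0
  show ?case using assms by (auto intro!: laurent_cong_refl laurent_polys_closed)
next
  case (Suc s)
  \<comment> \<open>The quotient by \<open>(1 - u)\<^sup>2\<close> in the step from \<open>s\<close>
    to \<open>Suc s\<close>, read off from \<open>eq\<close> and \<open>geo\<close> below.\<close>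
  define c where "c = - ((1 - u * w) ^ s * w * v * (\<Sum>i<Suc s. v ^ i))"
  have c: "c \<in> laurent_polys"
    unfolding c_def using assms by (intro laurent_polys_closed laurent_polys_1)
  \<comment> \<open>By \<open>u * v = 1\<close> the terms in \<open>w ^ 2\<close> cancel. For
    \<open>y = v ^ s\<close> the result has one visible factor \<open>1 - u\<close>; the geometric
    sum extracts a second one from \<open>1 - v ^ Suc s\<close>.\<close>
  have "(1 - v * y * w) * (1 - u * w) - (1 - y * w) * (1 - w) = w * (1 - u) * (1 - v * y)" for y
    using assms(4) by algebra
  hence eq: "(1 - v ^ Suc s * w) * (1 - u * w) - (1 - v ^ s * w) * (1 - w)
               = w * (1 - u) * (1 - v ^ Suc s)"
    by (simp only: power_Suc)
  have "1 - v ^ Suc s = (1 - v) * (\<Sum>i<Suc s. v ^ i)"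
    by (rule one_diff_power_eq)
  moreover have "1 - v = - ((1 - u) * v)"
    using assms(4) by algebra
  ultimately have geo: "1 - v ^ Suc s = - ((1 - u) * v) * (\<Sum>i<Suc s. v ^ i)"
    by simp
  have "(1 - v ^ Suc s * w) * (1 - u * w) ^ Suc s - (1 - v ^ s * w) * (1 - u * w) ^ s * (1 - w)
          = (1 - u * w) ^ s *
              ((1 - v ^ Suc s * w) * (1 - u * w) - (1 - v ^ s * w) * (1 - w))"
    by (simp add: algebra_simps)
  also have "\<dots> = (1 - u)\<^sup>2 * c"
    unfolding eq geo c_def power2_eq_square by (simp only: mult_ac mult_minus_left mult_minus_right)
  finally have "laurent_cong ((1 - u)\<^sup>2) ((1 - v ^ Suc s * w) * (1 - u * w) ^ Suc s)
                  ((1 - v ^ s * w) * (1 - u * w) ^ s * (1 - w))"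
    unfolding laurent_cong_def using assms c
    by (intro conjI bexI [of _ c] laurent_polys_closed laurent_polys_1)
  moreover have "laurent_cong ((1 - u)\<^sup>2) ((1 - v ^ s * w) * (1 - u * w) ^ s * (1 - w))
                   ((1 - w) ^ Suc s * (1 - w))"
    using assms
    by (intro laurent_cong_mult Suc.IH laurent_cong_refl laurent_polys_closed laurent_polys_1)
  ultimately show ?case
    using laurent_cong_trans by (simp only: power_Suc2 [of "1 - w" "Suc s"])
qed

lemma q_pochhammer_laurent_cong:
  assumes "u \<in> laurent_polys" "v \<in> laurent_polys" "a \<in> laurent_polys" "p \<in> laurent_polys" "u * v = 1"
  shows "laurent_cong ((1 - u)\<^sup>2) (q_pochhammer (v ^ s * a) p k * q_pochhammer (u * a) p k ^ s)
           (q_pochhammer a p k ^ Suc s)"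
proof -
  have "laurent_cong ((1 - u)\<^sup>2)
          (\<Prod>j<k. (1 - v ^ s * (a * p ^ j)) * (1 - u * (a * p ^ j)) ^ s)
          (\<Prod>j<k. (1 - a * p ^ j) ^ Suc s)"
    using assms by (intro laurent_cong_prod laurent_cong_perturb laurent_polys_closed) auto
  thus ?thesis
    by (simp only: q_pochhammer_def prod.distrib prod_power_distrib mult.assoc)
qed

section \<open>Sums and quotients under \<open>ratfun_cong_0\<close>\<close>

lemma ratfun_cong_0_zero: "ratfun_cong_0 0 P"
  unfolding ratfun_cong_0_def laurent_dvd_def
  by (intro bexI [of _ 0] exI [of _ 1]) auto

lemma ratfun_cong_0_add:
  assumes "ratfun_cong_0 f P" "ratfun_cong_0 g P"
  shows "ratfun_cong_0 (f + g) P"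
proof -
  obtain B C B' C' where *:
    "B \<noteq> 0" "coprime B P" "C \<in> laurent_polys" "f = to_fract P * C / to_fract B"
    "B' \<noteq> 0" "coprime B' P" "C' \<in> laurent_polys" "g = to_fract P * C' / to_fract B'"
    using assms unfolding ratfun_cong_0_def laurent_dvd_def by blast
  define A where "A = C * to_fract B' + C' * to_fract B"
  have A: "A \<in> laurent_polys"
    unfolding A_def using * by (intro laurent_polys_closed to_fract_in_laurent_polys)
  have "f + g = to_fract P * A / to_fract (B * B')"
    using * by (simp add: A_def field_simps)
  thus ?thesis
    unfolding ratfun_cong_0_def laurent_dvd_def using * A
    by (intro bexI [of _ "to_fract P * A"] exI [of _ "B * B'"])
       (auto intro!: laurent_polys_mult to_fract_in_laurent_polys)
qed

lemma ratfun_cong_0_sum: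
  "(\<And>i. i \<in> I \<Longrightarrow> ratfun_cong_0 (f i) P) \<Longrightarrow> ratfun_cong_0 (sum f I) P"
  by (induction I rule: infinite_finite_induct)
     (simp_all add: ratfun_cong_0_add ratfun_cong_0_zero)

lemma ratfun_cong_0_diff_divide:
  assumes "laurent_cong (to_fract E) x y" "P dvd E" "B \<noteq> 0" "coprime B P"
  shows "ratfun_cong_0 ((x - y) / to_fract B) P"
proof -
  obtain c where c: "c \<in> laurent_polys" "x - y = to_fract E * c"
    using assms(1) by (auto simp: laurent_cong_def)
  obtain G where "E = P * G" using assms(2) by (elim dvdE)
  hence eq: "x - y = to_fract P * (to_fract G * c)" using c by (simp add: mult_ac)
  have "to_fract G * c \<in> laurent_polys"
    using c by (intro laurent_polys_mult to_fract_in_laurent_polys)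
  thus ?thesis
    unfolding ratfun_cong_0_def laurent_dvd_def using assms eq
    by (intro bexI [of _ "x - y"] exI [of _ B])
       (auto intro!: laurent_polys_mult to_fract_in_laurent_polys)
qed

section \<open>Cyclotomic polynomials\<close>

lemma cyclotomic_nonzero:
  assumes "n > 0"
  shows "cyclotomic n \<noteq> 0"
proof
  assume "cyclotomic n = 0"
  hence "(\<Prod>w\<in>primitive_roots_unity n. [:-w, 1:]) = 0"
    using cyclotomic_conv_primitive_roots [OF assms] by simp
  thus False using finite_primitive_roots_unity [OF assms] by simp
qed

text \<open>Over the complex numbers the linear factors of the left side are among those of the
  right side; divisibility then descends to rational coefficients.\<close>

lemma cyclotomic_dvd:
  assumes "n > 0"
  shows "cyclotomic n dvd monom 1 n - 1"
proof (rule map_poly_of_rat_dvdD [where 'a = complex])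
  have "map_poly of_rat (monom 1 n - 1) = (monom 1 n - 1 :: complex poly)"
    by (simp add: map_poly_of_rat_diff map_poly_monom)
  also have "\<dots> = (\<Prod>w\<in>{w. w ^ n = 1}. [:-w, 1:])"
    by (rule monom_minus_one_conv_roots [OF assms])
  finally show "map_poly of_rat (cyclotomic n) dvd (map_poly of_rat (monom 1 n - 1) :: complex poly)"
    unfolding cyclotomic_conv_primitive_roots [OF assms]
    using assms by (auto simp: primitive_roots_unity_def intro!: prod_dvd_prod_subset finite_roots_unity)
qed (rule cyclotomic_nonzero [OF assms])

text \<open>A nonconstant common divisor would have a complex root \<open>w\<close>, which is a
  primitive \<open>n\<close>-th root of unity with \<open>w ^ l = 1\<close>; this forces
  \<open>n dvd l\<close>.\<close>

lemma coprime_cyclotomic: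
  assumes "n > 0" "\<not> n dvd l"
  shows "coprime (1 - monom 1 l) (cyclotomic n)"
proof (rule coprimeI)
  fix g :: "rat poly"
  assume g: "g dvd 1 - monom 1 l" "g dvd cyclotomic n"
  let ?h = "map_poly of_rat :: rat poly \<Rightarrow> complex poly"
  have h: "?h g dvd ?h f" if "g dvd f" for f
    using that by (auto elim!: dvdE simp: map_poly_of_rat_mult)
  have "degree (?h g) = 0"
  proof (rule ccontr)
    assume "degree (?h g) \<noteq> 0"
    hence "\<not> constant (poly (?h g))" by (simp add: constant_degree)
    then obtain w where w: "poly (?h g) w = 0"
      using fundamental_theorem_of_algebra by blast
    have root: "poly (?h f) w = 0" if "g dvd f" for f
      using h [OF that] w by (auto elim!: dvdE)
    have "w ^ l = 1"
      using root [OF g(1)] by (simp add: map_poly_of_rat_diff map_poly_monom poly_monom)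
    moreover have "w \<in> primitive_roots_unity n"
      using root [OF g(2)] finite_primitive_roots_unity [OF assms(1)]
      by (auto simp: cyclotomic_conv_primitive_roots [OF assms(1)] poly_prod)
    ultimately have w: "w ^ l = 1" "w ^ n = 1" "\<And>j. 0 < j \<Longrightarrow> j < n \<Longrightarrow> w ^ j \<noteq> 1"
      by (auto simp: primitive_roots_unity_def)
    have "w ^ l = (w ^ n) ^ (l div n) * w ^ (l mod n)"
      by (simp flip: power_mult power_add)
    hence "w ^ (l mod n) = 1" using w by simp
    thus False using w(3) [of "l mod n"] assms by (auto simp: dvd_eq_mod_eq_0)
  qed
  hence "degree g = 0" by (simp add: degree_map_poly)
  moreover have "g \<noteq> 0" using g(2) cyclotomic_nonzero [OF assms(1)] by auto
  ultimately show "is_unit g" by (simp add: is_unit_iff_degree)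
qed

section \<open>Powers of \<open>q_var\<close> and the denominators of the sum\<close>

lemma to_fract_prod: "to_fract (prod f I) = (\<Prod>i\<in>I. to_fract (f i))"
  by (induction I rule: infinite_finite_induct) simp_all

lemma to_fract_power: "to_fract (x ^ k) = to_fract x ^ k"
  by (induction k) simp_all

lemma q_var_power_neq_1:
  assumes "j > 0"
  shows "q_var ^ j \<noteq> 1"
proof
  assume "q_var ^ j = 1"
  hence "to_fract (monom 1 j) = to_fract (1 :: rat poly)"
    by (simp add: q_var_power)
  hence "monom 1 j = (1 :: rat poly)"
    by (simp only: to_fract_eq_iff)
  hence "degree (monom 1 j :: rat poly) = 0" by simp
  thus False using assms by (simp add: degree_monom_eq)
qed

text \<open>Each factor is \<open>1 - q^(d(j+1))\<close> with \<open>0 < j + 1 < n\<close>. As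
  \<open>d\<close> is coprime to \<open>n\<close>, the exponent is not a multiple of
  \<open>n\<close>, so \<open>coprime_cyclotomic\<close> applies.\<close>

lemma q_pochhammer_denominator:
  assumes "n > 0" "coprime d n" "k < n"
  obtains B where "B \<noteq> 0" "coprime B (cyclotomic n ^ t)"
    "q_pochhammer (q_var ^ d) (q_var ^ d) k ^ s = to_fract B"
proof
  let ?b = "\<lambda>j. 1 - monom 1 (d * Suc j) :: rat poly"
  have ndvd: "\<not> n dvd d * Suc j" if "j < k" for j
    using that assms coprime_dvd_mult_right_iff [of n d "Suc j"]
    by (auto simp: coprime_commute dest: dvd_imp_le)
  show "coprime ((\<Prod>j<k. ?b j) ^ s) (cyclotomic n ^ t)"
    using ndvd assms(1)
    by (intro coprime_power_left_iff [THEN iffD2] coprime_power_right_iff [THEN iffD2] disjI2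
          prod_coprime_left coprime_cyclotomic disjI1) auto
  have "?b j \<noteq> 0" if "j < k" for j
  proof
    assume "?b j = 0"
    hence "degree (monom 1 (d * Suc j) :: rat poly) = 0" by (metis degree_1 eq_iff_diff_eq_0)
    hence "d * Suc j = 0" by (simp add: degree_monom_eq)
    thus False using ndvd [OF that] by simp
  qed
  thus "(\<Prod>j<k. ?b j) ^ s \<noteq> 0" by simp
  show "q_pochhammer (q_var ^ d) (q_var ^ d) k ^ s = to_fract ((\<Prod>j<k. ?b j) ^ s)"
    unfolding q_pochhammer_def to_fract_power to_fract_prod
    by (simp flip: q_var_power power_mult power_add)
qed

theorem theorem1p1:
  fixes d n :: nat and r :: int
  assumes "d \<ge> 2"
    and "r \<le> int d - 2"
    and "gcd r (int d) = 1"
    and "n > 0"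
    and "[int n = - r] (mod int d)"
    and "int n \<ge> int d - r"
  shows "ratfun_cong_0
    (\<Sum>k=0..n-1.
       q_pochhammer (q_var powi r) (q_var ^ d) k ^ d * q_var ^ (d * k)
         / q_pochhammer (q_var ^ d) (q_var ^ d) k ^ d)
    (cyclotomic n ^ 2)"
proof -
  define p where "p = q_var ^ d"
  obtain s where s: "d = Suc s" using assms(1) by (cases d) auto
  have "int d dvd int n + r"
    using assms(5) by (simp add: cong_iff_dvd_diff)
  then obtain M where M: "int n + r = int d * M" by (elim dvdE)
  \<comment> \<open>The bound \<open>n >= d - r\<close> enters here: it makes \<open>M\<close>
    positive, so that \<open>M - 1\<close> is a natural number.\<close>
  have "int d * 1 \<le> int d * M" using M assms(6) by simp
  hence "M \<ge> 1" using assms(1) by simp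
  define m where "m = nat (M - 1)"
  have m: "int n + r = int d * int (Suc m)" using M \<open>M \<ge> 1\<close> by (simp add: m_def)
  \<comment> \<open>From \<open>r <= d - 2\<close>:
    \<open>n = d * (m + 1) - r >= d * m + 2 = s * m + m + 2\<close>.\<close>
  have "int (s * m) + int (Suc m) < int n"
    using m assms(2) s by (simp add: algebra_simps)
  hence *: "s * m + Suc m < n" by linarith
  define N where "N = n - Suc m"
  have N: "N < n" "s * m < N" "int N = int n - int (Suc m)"
    using * by (auto simp: N_def)
  have "coprime (int d) (int n)"
  proof -
    have "gcd (int d) (int n) = gcd (int d) (- r)"
      using cong_gcd_eq [OF assms(5)] by (simp add: gcd.commute)
    thus ?thesis using assms(3) by (simp add: coprime_iff_gcd_eq_1 gcd.commute)
  qed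
  hence "coprime d n" by simp

  have p: "p \<noteq> 0" "\<And>j. j > 0 \<Longrightarrow> p ^ j \<noteq> 1"
    using assms(1) q_var_power_neq_1 by (auto simp: p_def simp flip: power_mult)
  \<comment> \<open>Multiplying \<open>a\<close> by \<open>u\<close> or by \<open>v ^ s\<close>
    turns \<open>q^r\<close> into a power of \<open>p\<close>: the exponents \<open>r + n\<close>
    and \<open>r - s * n\<close> are both divisible by \<open>d\<close>.\<close>
  define u where "u = q_var ^ n"
  define v where "v = q_var powi (- int n)"
  define a where "a = q_var powi r"
  have L: "u \<in> laurent_polys" "v \<in> laurent_polys" "a \<in> laurent_polys" "p \<in> laurent_polys"
    using q_var_powi_in_laurent_polys [of "int _"] q_var_powi_in_laurent_polys
    by (simp_all add: u_def v_def a_def p_def)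
  have uv: "u * v = 1"
    by (simp add: u_def v_def power_int_minus)
  have ua: "u * a = p ^ Suc m"
  proof -
    have "u * a = q_var powi (int n + r)"
      by (simp add: u_def a_def power_int_add)
    also have "\<dots> = q_var powi (int (d * Suc m))" by (simp only: m of_nat_mult)
    also have "\<dots> = p ^ Suc m" by (simp only: p_def power_int_of_nat power_mult)
    finally show ?thesis .
  qed
  have va: "v ^ s * a = inverse p ^ N"
  proof -
    have "int d * int N = int d * int n - (int n + r)"
      unfolding m N(3) by (simp add: algebra_simps)
    hence "- int n * int s + r = - int (d * N)"
      by (simp add: s algebra_simps)
    moreover have "v ^ s * a = q_var powi (- int n * int s + r)"
      by (simp add: v_def a_def power_int_add power_int_mult del: mult_minus_left)
    ultimately have "v ^ s * a = q_var powi (- int (d * N))" by simp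
    also have "q_var powi (- int (d * N)) = inverse p ^ N"
      by (simp only: p_def power_int_minus power_int_of_nat power_mult power_inverse)
    finally show ?thesis .
  qed
  define E :: "rat poly" where "E = (1 - monom 1 n) ^ 2"
  have E: "(1 - u)\<^sup>2 = to_fract E"
    by (simp add: E_def u_def q_var_power to_fract_power)
  have "cyclotomic n dvd 1 - monom 1 n"
    using cyclotomic_dvd [OF assms(4)] by (subst dvd_minus_iff [symmetric]) simp
  hence PE: "cyclotomic n ^ 2 dvd E"
    unfolding E_def by (rule dvd_power_same)

  \<comment> \<open>\<open>X\<close> is the given numerator, \<open>Y\<close> its perturbation and
    \<open>Z\<close> the common denominator.\<close>
  define X where "X k = q_pochhammer a p k ^ d" for k
  define Y where "Y k = q_pochhammer (inverse p ^ N) p k * q_pochhammer (p ^ Suc m) p k ^ s" for k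
  define Z where "Z k = q_pochhammer p p k ^ d" for k
  \<comment> \<open>Since \<open>N < n\<close>, the range contains the whole terminating sum, which
    is exactly 0; subtracting it termwise leaves the total unchanged.\<close>
  have Y: "(\<Sum>k<n. Y k * p ^ k / Z k) = 0"
    using q_Karlsson_Minton_eq_0 [OF p N(1,2)] by (simp add: Y_def Z_def s)
  have "ratfun_cong_0 ((X k * p ^ k - Y k * p ^ k) / Z k) (cyclotomic n ^ 2)" if k: "k < n" for k
  proof -
    have "laurent_cong ((1 - u)\<^sup>2) (Y k) (X k)"
      using q_pochhammer_laurent_cong [OF L uv, of s k] by (simp only: X_def Y_def ua va s)
    \<comment> \<open>The sign in \<open>- (p ^ k)\<close> reverses the difference, giving
      \<open>X - Y\<close> instead of \<open>Y - X\<close>.\<close>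
    hence "laurent_cong (to_fract E) (Y k * - (p ^ k)) (X k * - (p ^ k))"
      unfolding E using L by (intro laurent_cong_mult laurent_cong_refl laurent_polys_closed)
    moreover obtain B where B: "B \<noteq> 0" "coprime B (cyclotomic n ^ 2)" "Z k = to_fract B"
      using q_pochhammer_denominator [OF assms(4) \<open>coprime d n\<close> k]
      unfolding Z_def p_def by blast
    ultimately have
      "ratfun_cong_0 ((Y k * - (p ^ k) - X k * - (p ^ k)) / to_fract B) (cyclotomic n ^ 2)"
      using PE by (intro ratfun_cong_0_diff_divide)
    thus ?thesis using B(3) by simp
  qed
  hence "ratfun_cong_0 (\<Sum>k<n. (X k * p ^ k - Y k * p ^ k) / Z k) (cyclotomic n ^ 2)"
    by (intro ratfun_cong_0_sum) simp
  also have "(\<Sum>k<n. (X k * p ^ k - Y k * p ^ k) / Z k) = (\<Sum>k<n. X k * p ^ k / Z k)"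
    using Y by (simp add: diff_divide_distrib sum_subtractf)
  also have "{..<n} = {0..n - 1}" using assms(4) by auto
  finally show ?thesis
    by (simp add: X_def Z_def a_def p_def power_mult)
qed

end
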